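(* Let $p,q\in(0,\infty]$ and $\alpha\in\mathbb{R}$, and let $\varphi_{\ell^{p,q;\alpha}}$ be the fundamental sequence of $\ell^{p,q;\alpha}$. (i) If $p<\infty$, then $\varphi_{\ell^{p,q;\alpha}}(n)\approx n^{\frac1p}(1+\log n)^\alpha$. (ii) If $p=\infty$, $q<\infty$, $\alpha>-\frac1q$, then $\varphi_{\ell^{p,q;\alpha}}(n)\approx(1+\log n)^{\alpha+\frac1q}$. (iii) If $p=\infty$, $q<\infty$, $\alpha=-\frac1q$, then $\varphi_{\ell^{p,q;\alpha}}(n)\approx(1+\log(1+\log n))^{-\alpha}$. (iv) If $p=\infty$, $q<\infty$, $\alpha<-\frac1q$, then $\varphi_{\ell^{p,q;\alpha}}(n)\approx1$. (v) If $p=\infty$, $q=\infty$, $\alpha>0$, then $\varphi_{\ell^{p,q;\alpha}}(n)\approx(1+\log n)^\alpha$. (vi) If $p=\infty$, $q=\infty$, $\alpha\le0$, then $\varphi_{\ell^{p,q;\alpha}}(n)\approx1$.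
   Context: $m$ is the counting measure on $\mathbb{N}=\{1,2,\dots\}$. For a sequence $a$ with values in $[-\infty,\infty]$, the non-increasing rearrangement is $a_n^*=\inf\{\lambda\in[0,\infty): m(\{k:|a_k|>\lambda\})\le n-1\}$. Convention $1/\infty=0$. $\|a\|_q=(\sum_n|a_n|^q)^{1/q}$ for $0<q<\infty$ and $\|a\|_\infty=\sup_n|a_n|$. $\|a\|_{p,q;\alpha}=\big\|\{a_n^*\,n^{\frac1p-\frac1q}(1+\log n)^\alpha\}_n\big\|_q$, and $\ell^{p,q;\alpha}$ is the space of sequences with $\|a\|_{p,q;\alpha}<\infty$. The fundamental sequence of a rearrangement-invariant sequence space $X$ is $\varphi_X(n)=\|\chi_{E_n}\|_X$, where $\chi_{E_n}$ is the characteristic sequence of any set $E_n\subset\mathbb{N}$ with $m(E_n)=n$ (e.g. $E_n=\{1,\dots,n\}$). $x(n)\approx y(n)$ means there are constants $c,C>0$, independent of $n$, with $c\,y(n)\le x(n)\le C\,y(n)$ for all $n\in\mathbb{N}$, $n\ge1$. *)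

theory Defs
  imports "HOL-Analysis.Analysis"
begin

text \<open>
  Sequences on \<open>{1, 2, \<dots>}\<close> are functions \<open>nat \<Rightarrow> ereal\<close>; the entry at index \<open>0\<close>
  never plays a role. Exponents in \<open>(0, \<infinity>]\<close> have type \<^typ>\<open>ennreal\<close>, where
  \<open>1 / \<infinity> = 0\<close> holds, so that \<open>recip p\<close> is the real number \<open>1 / p\<close> for all \<open>p > 0\<close>.
\<close>

definition recip :: "ennreal \<Rightarrow> real" where
  "recip p = enn2real (1 / p)"

text \<open>The power \<open>x\<^sup>r\<close> of \<open>x \<in> [0, \<infinity>]\<close>; it is only used for \<open>r > 0\<close>, so that
  \<open>\<infinity>\<^sup>r = \<infinity>\<close> and \<open>0\<^sup>r = 0\<close>.\<close>

definition epowr :: "ennreal \<Rightarrow> real \<Rightarrow> ennreal" where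
  "epowr x r = (if x = \<infinity> then \<infinity> else ennreal (enn2real x powr r))"

definition rearr :: "(nat \<Rightarrow> ereal) \<Rightarrow> nat \<Rightarrow> ereal" where
  "rearr a n = Inf {l. 0 \<le> l \<and> l < \<infinity> \<and>
     emeasure (count_space {1..}) {k \<in> {1..}. \<bar>a k\<bar> > l} \<le> of_nat (n - 1)}"

definition lq_norm :: "ennreal \<Rightarrow> (nat \<Rightarrow> ereal) \<Rightarrow> ennreal" where
  "lq_norm q a = (if q = \<infinity> then (SUP n\<in>{1..}. e2ennreal \<bar>a n\<bar>)
     else epowr (\<Sum>\<^sub>\<infinity>n\<in>{1..}. epowr (e2ennreal \<bar>a n\<bar>) (enn2real q)) (recip q))"

definition lz_norm :: "ennreal \<Rightarrow> ennreal \<Rightarrow> real \<Rightarrow> (nat \<Rightarrow> ereal) \<Rightarrow> ennreal" where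
  "lz_norm p q \<alpha> a =
     lq_norm q (\<lambda>n. rearr a n * ereal (real n powr (recip p - recip q) * (1 + ln (real n)) powr \<alpha>))"

definition lz_space :: "ennreal \<Rightarrow> ennreal \<Rightarrow> real \<Rightarrow> (nat \<Rightarrow> ereal) set" where
  "lz_space p q \<alpha> = {a. lz_norm p q \<alpha> a < \<infinity>}"

text \<open>The fundamental sequence of the space of all \<open>a\<close> with \<open>N a < \<infinity>\<close>, for a
  rearrangement-invariant functional \<open>N\<close>. By invariance any other set of \<open>n\<close> positive integers
  may replace \<open>{1..n}\<close>; see \<open>fundamental_seq_lz\<close> below.\<close>

definition fundamental_seq :: "((nat \<Rightarrow> ereal) \<Rightarrow> ennreal) \<Rightarrow> nat \<Rightarrow> ennreal" where
  "fundamental_seq N n = N (indicator {1..n})"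

abbreviation fundamental_lz :: "ennreal \<Rightarrow> ennreal \<Rightarrow> real \<Rightarrow> nat \<Rightarrow> ennreal" where
  "fundamental_lz p q \<alpha> \<equiv> fundamental_seq (lz_norm p q \<alpha>)"

definition equiv_seq :: "(nat \<Rightarrow> ennreal) \<Rightarrow> (nat \<Rightarrow> real) \<Rightarrow> bool"  (infix "\<asymp>" 50) where
  "x \<asymp> y \<longleftrightarrow> (\<exists>c C :: real. c > 0 \<and> C > 0 \<and>
     (\<forall>n\<ge>1. ereal (c * y n) \<le> enn2ereal (x n) \<and> enn2ereal (x n) \<le> ereal (C * y n)))"

lemma rearr_indicator_cong:
  assumes "E \<subseteq> {1..}" "finite E" "F \<subseteq> {1..}" "finite F" "card E = card F"
  shows "rearr (indicator E) = rearr (indicator F)"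
proof -
  have eq: "emeasure (count_space {1..}) {k \<in> {1..}. \<bar>indicator A k :: ereal\<bar> > l} =
      (if l < 1 then of_nat (card A) else 0)"
    if "A \<subseteq> {1..}" "finite A" "0 \<le> l" for A :: "nat set" and l :: ereal
  proof -
    have "{k \<in> {1..}. \<bar>indicator A k :: ereal\<bar> > l} = (if l < 1 then A else {})"
      using that by (auto simp: indicator_def split: if_splits)
    then show ?thesis
      using that by (simp add: emeasure_count_space_finite)
  qed
  have "emeasure (count_space {1..}) {k \<in> {1..}. \<bar>indicator E k :: ereal\<bar> > l} =
      emeasure (count_space {1..}) {k \<in> {1..}. \<bar>indicator F k :: ereal\<bar> > l}"
    if "0 \<le> l" for l :: ereal
    by (simp only: eq[OF assms(1,2) that] eq[OF assms(3,4) that] assms(5))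
  then show ?thesis
    unfolding rearr_def by (intro ext arg_cong[of _ _ Inf] Collect_cong conj_cong refl) simp
qed

lemma fundamental_seq_lz:
  assumes "E \<subseteq> {1..}" "finite E" "card E = n"
  shows "fundamental_lz p q \<alpha> n = lz_norm p q \<alpha> (indicator E)"
proof -
  have "rearr (indicator {1..n}) = rearr (indicator E)"
    by (rule rearr_indicator_cong) (use assms in auto)
  then show ?thesis
    by (simp add: fundamental_seq_def lz_norm_def)
qed

end

theory Submission
  imports Defs
begin

text \<open>
  The norm of \<open>\<chi>\<close> on \<open>{1..n}\<close> is the \<open>\<ell>\<^sup>q\<close>-norm of the first \<open>n\<close> weights, so everything reduces
  to the growth of the sums \<open>\<Sum>k\<le>n. k\<^sup>s\<^sup>-\<^sup>1 (1 + log k)\<^sup>b\<close> with \<open>s = q/p\<close>, \<open>b = \<alpha>q\<close> (or of a maximum,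
  if \<open>q = \<infinity>\<close>). For \<open>s = 0\<close> the summand has an explicit antiderivative and is constant up to a factor
  on \<open>[k, k + 1]\<close>, so the sum is comparable to the antiderivative. For \<open>s > 0\<close> the logarithmic factor
  at \<open>k\<close> differs from the one at \<open>n\<close> by at most a small power of \<open>n/k\<close>, which reduces the
  sum to one of pure powers.
\<close>

section \<open>Reciprocal exponents and the norm of an indicator\<close>

lemma recip_eq_inverse:
  assumes "0 < q" "q < \<infinity>"
  shows "recip q = 1 / enn2real q"
proof -
  obtain r where r: "q = ennreal r" "r > 0"
    using assms by (cases q) (auto simp: less_top)
  show ?thesis
    unfolding recip_def r(1) using r(2) by (simp add: divide_ennreal flip: ennreal_1)
qed

lemma recip_pos:
  assumes "0 < p" "p < \<infinity>"
  shows "0 < recip p"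
  using assms by (simp add: recip_eq_inverse enn2real_positive_iff)

lemma recip_infinity [simp]: "recip \<infinity> = 0" "recip top = 0"
  by (simp_all add: recip_def)

text \<open>Levels in \<open>[0, 1)\<close> are exceeded at exactly \<open>n\<close> places and
  higher levels nowhere, so a finite level \<open>l \<ge> 0\<close> is admissible iff
  \<open>k > n\<close> or \<open>l \<ge> 1\<close>.\<close>

lemma rearr_indicator:
  assumes "k \<ge> 1"
  shows "rearr (indicator {1..n}) k = (if k \<le> n then 1 else 0)"
proof -
  have eq: "emeasure (count_space {1..}) {j \<in> {1..}. \<bar>indicator {1..n} j :: ereal\<bar> > l} =
      of_nat (if l < 1 then n else 0)" if "0 \<le> l" for l :: ereal
  proof -
    have "{j \<in> {1..}. \<bar>indicator {1..n} j :: ereal\<bar> > l} = (if l < 1 then {1..n} else {})"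
      using that by (auto simp: indicator_def split: if_splits)
    then show ?thesis by (auto simp: emeasure_count_space_finite)
  qed
  have "rearr (indicator {1..n}) k = Inf {l. 0 \<le> l \<and> l < \<infinity> \<and> (k \<le> n \<longrightarrow> 1 \<le> l)}"
    unfolding rearr_def
  proof (intro arg_cong[of _ _ Inf] Collect_cong conj_cong refl)
    fix l :: ereal assume "0 \<le> l"
    \<comment> \<open>For \<open>l < 1\<close> the claim reads \<open>n \<le> k - 1\<close> iff not
      \<open>k \<le> n\<close>; \<open>k \<ge> 1\<close> keeps the truncated subtraction
      honest.\<close>
    then show "emeasure (count_space {1..}) {j \<in> {1..}. \<bar>indicator {1..n} j :: ereal\<bar> > l} \<le> of_nat (k - 1)
        \<longleftrightarrow> (k \<le> n \<longrightarrow> 1 \<le> l)"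
      unfolding eq[OF \<open>0 \<le> l\<close>] of_nat_le_iff using assms by auto
  qed
  also have "\<dots> = (if k \<le> n then 1 else 0)"
    by (intro cInf_eq_minimum) auto
  finally show ?thesis .
qed

lemma rearr_indicator_weight:
  assumes "k \<ge> 1" "w \<ge> 0"
  shows "e2ennreal \<bar>rearr (indicator {1..n}) k * ereal w\<bar> = (if k \<le> n then ennreal w else 0)"
  unfolding rearr_indicator[OF assms(1)] using assms(2) by (simp add: e2ennreal_neg)

text \<open>Taking \<open>q\<close>-th powers turns the exponent \<open>1/p - 1/q\<close> of the
  weight into \<open>q/p - 1\<close>, and the entries beyond \<open>n\<close> vanish, which makes
  the series a finite sum.\<close>

lemma fundamental_lz_finite:
  assumes "0 < q" "q < \<infinity>"
  shows "fundamental_lz p q \<alpha> n = ennreal ((\<Sum>k=1..n. real k powr (enn2real q * recip p - 1) *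
    (1 + ln (real k)) powr (\<alpha> * enn2real q)) powr recip q)"
proof -
  define Q where "Q = enn2real q"
  have Q: "Q > 0" "recip q = 1 / Q"
    using assms recip_eq_inverse[OF assms] by (auto simp: Q_def enn2real_positive_iff less_top)
  define w where "w k = real k powr (recip p - recip q) * (1 + ln (real k)) powr \<alpha>" for k
  define t where "t k = real k powr (Q * recip p - 1) * (1 + ln (real k)) powr (\<alpha> * Q)" for k
  have w0: "w k \<ge> 0" for k by (simp add: w_def)
  have t0: "t k \<ge> 0" for k by (simp add: t_def)
  have wt: "w k powr Q = t k" for k
    using Q by (simp add: w_def t_def powr_mult powr_powr field_simps)
  have "(\<Sum>\<^sub>\<infinity>k\<in>{1..}. epowr (e2ennreal \<bar>rearr (indicator {1..n}) k * ereal (w k)\<bar>) Q)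
      = (\<Sum>\<^sub>\<infinity>k\<in>{1..n}. ennreal (t k))"
    using w0 Q by (intro infsum_cong_neutral)
      (auto simp: rearr_indicator_weight epowr_def wt simp del: One_nat_def)
  also have "\<dots> = ennreal (\<Sum>k=1..n. t k)"
    using t0 by simp
  finally show ?thesis
    using assms unfolding fundamental_seq_def lz_norm_def lq_norm_def
    by (simp add: epowr_def w_def t_def Q_def sum_nonneg enn2real_ennreal)
qed

text \<open>Here \<open>1/q = 0\<close>, so the weight keeps only \<open>1/p\<close>; the entries
  beyond \<open>n\<close> are 0, the least element, and do not affect the supremum.\<close>

lemma fundamental_lz_infinity:
  "fundamental_lz p \<infinity> \<alpha> n =
    (SUP k\<in>{1..n}. ennreal (real k powr recip p * (1 + ln (real k)) powr \<alpha>))"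
proof -
  define w where "w k = real k powr recip p * (1 + ln (real k)) powr \<alpha>" for k
  have w0: "w k \<ge> 0" for k by (simp add: w_def)
  have eq: "e2ennreal \<bar>rearr (indicator {1..n}) k * ereal (w k)\<bar> =
      (if k \<le> n then ennreal (w k) else 0)" if "k \<ge> 1" for k
    using that w0 by (rule rearr_indicator_weight)
  have "(SUP k\<in>{1..}. e2ennreal \<bar>rearr (indicator {1..n}) k * ereal (w k)\<bar>)
      = (SUP k\<in>{1..n}. ennreal (w k))"
  proof (intro antisym SUP_least)
    fix k :: nat assume "k \<in> {1..}"
    then show "e2ennreal \<bar>rearr (indicator {1..n}) k * ereal (w k)\<bar> \<le> (SUP k\<in>{1..n}. ennreal (w k))"
      by (subst eq) (auto intro: SUP_upper)
  next
    fix k assume "k \<in> {1..n}"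
    then show "ennreal (w k) \<le> (SUP k\<in>{1..}. e2ennreal \<bar>rearr (indicator {1..n}) k * ereal (w k)\<bar>)"
      by (intro SUP_upper2[of k]) (auto simp: eq simp del: One_nat_def)
  qed
  then show ?thesis
    by (simp add: fundamental_seq_def lz_norm_def lq_norm_def w_def)
qed

section \<open>Rules for the relation \<open>\<asymp>\<close>\<close>

text \<open>Nonnegativity of \<open>y\<close> is assumed because \<open>ennreal\<close> maps
  negative reals to 0, so that an upper bound by \<open>ennreal (C * y n)\<close> would otherwise
  say too little.\<close>

lemma equiv_seqI:
  assumes "c > 0" "C > 0" "\<And>n. n \<ge> 1 \<Longrightarrow> 0 \<le> y n"
    and "\<And>n. n \<ge> 1 \<Longrightarrow> ennreal (c * y n) \<le> x n"
    and "\<And>n. n \<ge> 1 \<Longrightarrow> x n \<le> ennreal (C * y n)"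
  shows "x \<asymp> y"
proof -
  have "ereal (c * y n) \<le> enn2ereal (x n)" "enn2ereal (x n) \<le> ereal (C * y n)" if "n \<ge> 1" for n
    using assms that unfolding less_eq_ennreal.rep_eq by (simp_all add: enn2ereal_ennreal)
  then show ?thesis
    using assms(1,2) unfolding equiv_seq_def by blast
qed

lemma equiv_seq_ennrealE:
  assumes "(\<lambda>n. ennreal (s n)) \<asymp> y" "\<And>n. n \<ge> 1 \<Longrightarrow> 0 \<le> s n"
  obtains c C where "c > 0" "C > 0" "\<And>n. n \<ge> 1 \<Longrightarrow> c * y n \<le> s n" "\<And>n. n \<ge> 1 \<Longrightarrow> s n \<le> C * y n"
  using assms unfolding equiv_seq_def by (auto simp: enn2ereal_ennreal)

lemma equiv_seq_powr:
  assumes "(\<lambda>n. ennreal (s n)) \<asymp> y" "\<And>n. n \<ge> 1 \<Longrightarrow> 0 \<le> s n" "\<And>n. n \<ge> 1 \<Longrightarrow> 0 \<le> y n" "0 \<le> r"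
  shows "(\<lambda>n. ennreal (s n powr r)) \<asymp> (\<lambda>n. y n powr r)"
proof -
  obtain c C where c: "c > 0" "C > 0" "\<And>n. n \<ge> 1 \<Longrightarrow> c * y n \<le> s n" "\<And>n. n \<ge> 1 \<Longrightarrow> s n \<le> C * y n"
    using equiv_seq_ennrealE[OF assms(1,2)] by metis
  show ?thesis
  proof (rule equiv_seqI)
    show "c powr r > 0" "C powr r > 0" using c by auto
    fix n :: nat assume n: "n \<ge> 1"
    have "(c * y n) powr r \<le> s n powr r"
      using c n assms by (intro powr_mono2) auto
    then show "ennreal (c powr r * y n powr r) \<le> ennreal (s n powr r)"
      using c n assms by (intro ennreal_leI) (simp add: powr_mult)
    have "s n powr r \<le> (C * y n) powr r"
      using c n assms by (intro powr_mono2) auto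
    then show "ennreal (s n powr r) \<le> ennreal (C powr r * y n powr r)"
      using c n assms by (intro ennreal_leI) (simp add: powr_mult)
  qed auto
qed

text \<open>For passing from an antiderivative to a simpler sequence of the same growth; the
  constants multiply.\<close>

lemma equiv_seq_trans_const:
  assumes "x \<asymp> y" "c > 0" "C > 0" "\<And>n. n \<ge> 1 \<Longrightarrow> c * z n \<le> y n" "\<And>n. n \<ge> 1 \<Longrightarrow> y n \<le> C * z n"
  shows "x \<asymp> z"
proof -
  obtain a A where a: "a > 0" "A > 0"
    and le: "\<And>n. n \<ge> 1 \<Longrightarrow> ereal (a * y n) \<le> enn2ereal (x n) \<and> enn2ereal (x n) \<le> ereal (A * y n)"
    using assms(1) unfolding equiv_seq_def by blast
  have "ereal (a * c * z n) \<le> enn2ereal (x n) \<and> enn2ereal (x n) \<le> ereal (A * C * z n)" if "n \<ge> 1" for n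
  proof -
    have "a * (c * z n) \<le> a * y n" "A * y n \<le> A * (C * z n)"
      using a assms(4,5)[OF that] by (simp_all add: mult_left_mono)
    then show ?thesis
      using le[OF that] by (metis ereal_less_eq(3) mult.assoc order_trans)
  qed
  then show ?thesis
    unfolding equiv_seq_def using a assms(2,3)
    by (intro exI[of _ "a * c"] exI[of _ "A * C"]) auto
qed

section \<open>Sums compared with antiderivatives\<close>

text \<open>By the mean value theorem \<open>F (k + 1) - F k\<close> is a value of \<open>g\<close>
  inside \<open>[k, k + 1]\<close>, hence comparable to both \<open>g k\<close> and
  \<open>g (k + 1)\<close>. Telescoping compares the sum with \<open>F n\<close> up to additive
  constants, and \<open>F 1 > 0\<close> allows these to be absorbed.\<close>

lemma sum_equiv_antiderivative:
  fixes F g :: "real \<Rightarrow> real"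
  assumes deriv: "\<And>x. x \<ge> 1 \<Longrightarrow> (F has_real_derivative g x) (at x)"
    and pos: "\<And>x. x \<ge> 1 \<Longrightarrow> g x > 0" and F1: "F 1 > 0" and A: "A > 0"
    and quasi: "\<And>x y. \<lbrakk>1 \<le> x; x \<le> y; y \<le> x + 1\<rbrakk> \<Longrightarrow> g x \<le> A * g y"
      "\<And>x y. \<lbrakk>1 \<le> x; x \<le> y; y \<le> x + 1\<rbrakk> \<Longrightarrow> g y \<le> A * g x"
  shows "(\<lambda>n. ennreal (\<Sum>k=1..n. g (real k))) \<asymp> (\<lambda>n. F (real n))"
proof -
  have incr: "F (real k + 1) - F k \<le> A * g k \<and> g (real k + 1) \<le> A * (F (real k + 1) - F k)"
    if "k \<ge> 1" for k :: nat
  proof -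
    have "\<exists>z>real k. z < real k + 1 \<and> F (real k + 1) - F k = (real k + 1 - real k) * g z"
      using deriv that by (intro MVT2) auto
    then obtain z where z: "z > real k" "z < real k + 1" "F (real k + 1) - F k = g z"
      by auto
    then show ?thesis
      using quasi(1)[of z "real k + 1"] quasi(2)[of "real k" z] quasi(2)[of z "real k + 1"] that by auto
  qed
  \<comment> \<open>The increment over \<open>[k, k + 1]\<close> pays for the summand at
    \<open>k + 1\<close>, so the summand at 1 is left over as an additive term.\<close>
  have ub: "(\<Sum>k=1..n. g k) \<le> g 1 + A * (F n - F 1)" if "n \<ge> 1" for n :: nat
    using that
  proof (induction n rule: dec_induct)
    case (step n)
    then show ?case using incr[of n] step.hyps by (simp add: algebra_simps)
  qed auto
  have lb: "F n - F 1 \<le> A * (\<Sum>k=1..<n. g k)" if "n \<ge> 1" for n :: nat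
    using that
  proof (induction n rule: dec_induct)
    case (step n)
    then show ?case using incr[of n] step.hyps by (simp add: algebra_simps)
  qed auto
  have mono: "F 1 \<le> F n" if "n \<ge> 1" for n :: nat
    using that deriv pos
    by (intro DERIV_nonneg_imp_nondecreasing[of 1 "real n" F]) (auto intro: less_imp_le)
  show ?thesis
  proof (rule equiv_seqI)
    \<comment> \<open>The additive terms become multiplicative: \<open>F 1\<close> is at most
      \<open>F 1 / g 1\<close> times the sum, since the sum is at least \<open>g 1\<close>; and
      \<open>g 1\<close> is at most \<open>g 1 / F 1\<close> times \<open>F n\<close>, since
      \<open>F n \<ge> F 1\<close>.\<close>
    show "1 / (A + F 1 / g 1) > 0" "A + g 1 / F 1 > 0"
      using A F1 pos[of 1] by (simp_all add: add_pos_pos)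
    fix n :: nat assume n: "n \<ge> 1"
    show "F n \<ge> 0" using mono[OF n] F1 by simp
    have g1: "g 1 \<le> (\<Sum>k=1..n. g k)"
      using n pos member_le_sum[of "1::nat" "{1..n}" "\<lambda>k. g (real k)"] by (force intro: less_imp_le)
    have "(\<Sum>k=1..<n. g k) \<le> (\<Sum>k=1..n. g k)"
      using pos by (intro sum_mono2) (auto intro: less_imp_le)
    then have "F n \<le> F 1 + A * (\<Sum>k=1..n. g k)"
      using lb[OF n] A by (smt (verit) mult_left_mono)
    also have "F 1 \<le> F 1 / g 1 * (\<Sum>k=1..n. g k)"
      using g1 F1 pos[of 1] by (simp add: field_simps)
    finally have "F n \<le> (A + F 1 / g 1) * (\<Sum>k=1..n. g k)"
      by (simp add: algebra_simps)
    then have "1 / (A + F 1 / g 1) * F n \<le> (\<Sum>k=1..n. g k)"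
      using \<open>1 / (A + F 1 / g 1) > 0\<close> by (simp add: divide_le_eq mult.commute)
    then show "ennreal (1 / (A + F 1 / g 1) * F n) \<le> ennreal (\<Sum>k=1..n. g k)"
      by (rule ennreal_leI)
    have "(\<Sum>k=1..n. g k) \<le> g 1 + A * F n"
      using ub[OF n] A F1 by (smt (verit) mult_left_mono)
    also have "g 1 \<le> g 1 / F 1 * F n"
      using mono[OF n] F1 pos[of 1] by (simp add: field_simps)
    finally have "(\<Sum>k=1..n. g k) \<le> (A + g 1 / F 1) * F n"
      by (simp add: algebra_simps)
    then show "ennreal (\<Sum>k=1..n. g k) \<le> ennreal ((A + g 1 / F 1) * F n)"
      by (rule ennreal_leI)
  qed
qed

lemma one_plus_ln_pos:
  fixes x :: real
  assumes "x \<ge> 1"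
  shows "1 + ln x > 0"
  using ln_ge_zero[OF assms] by linarith

text \<open>The ratio \<open>y / x\<close> lies in \<open>[1, 2]\<close>, so its powers with
  exponents \<open>a\<close> and \<open>- a\<close> are at most
  \<open>2 powr \<bar>a\<bar>\<close>.\<close>

lemma powr_comparable_doubling:
  fixes x y :: real
  assumes "0 < x" "x \<le> y" "y \<le> 2 * x"
  shows "x powr a \<le> 2 powr \<bar>a\<bar> * y powr a" "y powr a \<le> 2 powr \<bar>a\<bar> * x powr a"
proof -
  have *: "t powr b \<le> 2 powr \<bar>b\<bar>" if "1 \<le> t" "t \<le> 2" for t b :: real
  proof (cases "b \<ge> 0")
    case True
    then show ?thesis using that by (auto intro: powr_mono2)
  next
    case False
    then have "t powr b \<le> 1 powr b" using that by (intro powr_mono2') auto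
    then show ?thesis using ge_one_powr_ge_zero[of 2 "\<bar>b\<bar>"] by simp
  qed
  have "(y / x) powr a \<le> 2 powr \<bar>a\<bar>" "(y / x) powr (- a) \<le> 2 powr \<bar>a\<bar>"
    using *[of "y / x" a] *[of "y / x" "- a"] assms by (auto simp: field_simps)
  then show "x powr a \<le> 2 powr \<bar>a\<bar> * y powr a" "y powr a \<le> 2 powr \<bar>a\<bar> * x powr a"
    using assms by (auto simp: powr_divide powr_minus field_simps)
qed

text \<open>On \<open>[x, x + 1]\<close> with \<open>x \<ge> 1\<close> both bases at most double:
  \<open>x + 1 \<le> 2 * x\<close>, and \<open>ln 2 \<le> 1\<close> gives
  \<open>1 + ln y \<le> 2 * (1 + ln x)\<close>.\<close>

lemma sum_powr_ln_equiv_antiderivative: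
  fixes F :: "real \<Rightarrow> real"
  assumes "\<And>x. x \<ge> 1 \<Longrightarrow> (F has_real_derivative x powr a * (1 + ln x) powr b) (at x)" "F 1 > 0"
  shows "(\<lambda>n. ennreal (\<Sum>k=1..n. real k powr a * (1 + ln (real k)) powr b)) \<asymp> (\<lambda>n. F (real n))"
proof (rule sum_equiv_antiderivative[where A = "2 powr \<bar>a\<bar> * 2 powr \<bar>b\<bar>" and g = "\<lambda>x. x powr a * (1 + ln x) powr b"])
  fix x :: real assume "x \<ge> 1"
  then show "x powr a * (1 + ln x) powr b > 0" using one_plus_ln_pos[of x] by simp
next
  fix x y :: real assume xy: "1 \<le> x" "x \<le> y" "y \<le> x + 1"
  have "ln x \<ge> 0" "ln x \<le> ln y" using xy by auto
  have "ln y \<le> ln (2 * x)" using xy by (subst ln_le_cancel_iff) auto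
  also have "\<dots> \<le> 1 + ln x" using xy ln_le_minus_one[of 2] by (simp add: ln_mult)
  finally have "1 + ln y \<le> 2 * (1 + ln x)" using \<open>ln x \<ge> 0\<close> by simp
  with powr_comparable_doubling[of x y a] powr_comparable_doubling[of "1 + ln x" "1 + ln y" b] xy \<open>ln x \<ge> 0\<close> \<open>ln x \<le> ln y\<close>
  have *: "x powr a \<le> 2 powr \<bar>a\<bar> * y powr a" "y powr a \<le> 2 powr \<bar>a\<bar> * x powr a"
    "(1 + ln x) powr b \<le> 2 powr \<bar>b\<bar> * (1 + ln y) powr b"
    "(1 + ln y) powr b \<le> 2 powr \<bar>b\<bar> * (1 + ln x) powr b"
    by auto
  show "x powr a * (1 + ln x) powr b \<le> 2 powr \<bar>a\<bar> * 2 powr \<bar>b\<bar> * (y powr a * (1 + ln y) powr b)"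
    using mult_mono[OF *(1,3)] by (simp add: mult_ac)
  show "y powr a * (1 + ln y) powr b \<le> 2 powr \<bar>a\<bar> * 2 powr \<bar>b\<bar> * (x powr a * (1 + ln x) powr b)"
    using mult_mono[OF *(2,4)] by (simp add: mult_ac)
qed (use assms in auto)

section \<open>Sums with a positive power\<close>

text \<open>For \<open>\<gamma> \<ge> 0\<close> this is monotonicity with \<open>D = 1\<close>. For
  \<open>\<gamma> < 0\<close> it rests on
  \<open>1 + ln y \<le> (1 + ln (y / x)) * (1 + ln x)\<close>, where the first factor is dominated
  by a small power of \<open>y / x\<close>.\<close>

lemma ln_powr_ratio_bound:
  fixes \<gamma> \<epsilon> :: real
  assumes "\<epsilon> > 0"
  obtains D where "D > 0"
    "\<And>x y :: real. \<lbrakk>1 \<le> x; x \<le> y\<rbrakk> \<Longrightarrow> (1 + ln x) powr \<gamma> \<le> D * (y / x) powr \<epsilon> * (1 + ln y) powr \<gamma>"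
proof (cases "\<gamma> \<ge> 0")
  case True
  have "(1 + ln x) powr \<gamma> \<le> 1 * (y / x) powr \<epsilon> * (1 + ln y) powr \<gamma>" if "1 \<le> x" "x \<le> y" for x y :: real
  proof -
    have "(1 + ln x) powr \<gamma> \<le> (1 + ln y) powr \<gamma>"
      using that True by (intro powr_mono2) (auto intro: add_nonneg_nonneg)
    also have "\<dots> \<le> (y / x) powr \<epsilon> * (1 + ln y) powr \<gamma>"
      using that assms mult_right_mono[OF ge_one_powr_ge_zero[of "y / x" \<epsilon>]] by fastforce
    finally show ?thesis by simp
  qed
  then show thesis using that[of 1] by simp
next
  case False
  \<comment> \<open>Chosen so that raising \<open>t powr \<delta>\<close> to the power
    \<open>- \<gamma>\<close> gives exactly \<open>t powr \<epsilon>\<close>.\<close>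
  define \<delta> where "\<delta> = \<epsilon> / (- \<gamma>)"
  have \<delta>: "\<delta> > 0" using False assms by (simp add: \<delta>_def divide_pos_neg)
  define B where "B = 1 + 1 / \<delta>"
  have B: "B > 0" using \<delta> by (simp add: B_def add_pos_pos)
  have "(1 + ln x) powr \<gamma> \<le> B powr (- \<gamma>) * (y / x) powr \<epsilon> * (1 + ln y) powr \<gamma>"
    if xy: "1 \<le> x" "x \<le> y" for x y :: real
  proof -
    define t where "t = y / x"
    have t: "t \<ge> 1" using xy by (simp add: t_def)
    have l: "ln x \<ge> 0" "ln y \<ge> 0" "ln t \<ge> 0" using xy t by auto
    \<comment> \<open>From \<open>ln u \<le> u - 1\<close> at \<open>u = t powr \<delta>\<close>;
      the two summands of \<open>B\<close> come from bounding 1 and \<open>ln t\<close> separately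
      by multiples of \<open>t powr \<delta>\<close>.\<close>
    have "ln (t powr \<delta>) \<le> t powr \<delta>" using t ln_le_minus_one[of "t powr \<delta>"] by simp
    then have "ln t \<le> 1 / \<delta> * t powr \<delta>" using t \<delta> by (simp add: ln_powr field_simps)
    moreover have "1 \<le> t powr \<delta>" using t \<delta> by (intro ge_one_powr_ge_zero) auto
    ultimately have lt: "1 + ln t \<le> B * t powr \<delta>" by (simp add: B_def algebra_simps)
    have "ln y = ln x + ln t" using xy by (simp add: t_def ln_div)
    then have "1 + ln y \<le> (1 + ln t) * (1 + ln x)" using l by (simp add: algebra_simps)
    also have "\<dots> \<le> B * t powr \<delta> * (1 + ln x)" using lt l by (intro mult_right_mono) auto
    finally have "(1 + ln y) powr (- \<gamma>) \<le> (B * t powr \<delta> * (1 + ln x)) powr (- \<gamma>)"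
      using l False by (intro powr_mono2) auto
    also have "\<dots> = B powr (- \<gamma>) * t powr \<epsilon> * (1 + ln x) powr (- \<gamma>)"
      using B l False by (simp add: powr_mult powr_powr \<delta>_def)
    finally have "1 / (1 + ln y) powr \<gamma> \<le> B powr (- \<gamma>) * t powr \<epsilon> / (1 + ln x) powr \<gamma>"
      unfolding powr_minus_divide[of "1 + ln x"] powr_minus_divide[of "1 + ln y"] by simp
    moreover have "(1 + ln x) powr \<gamma> > 0" "(1 + ln y) powr \<gamma> > 0"
      using l by auto
    ultimately show ?thesis
      unfolding t_def by (simp add: divide_le_eq pos_le_divide_eq mult.commute)
  qed
  then show thesis using that[of "B powr (- \<gamma>)"] B by simp
qed

lemma sum_powr_equiv:
  assumes "t > 0"
  shows "(\<lambda>n. ennreal (\<Sum>k=1..n. real k powr (t - 1))) \<asymp> (\<lambda>n. real n powr t)"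
proof (rule equiv_seq_trans_const[of _ "\<lambda>n. real n powr t / t" "1 / t" "1 / t"])
  have "(\<lambda>n. ennreal (\<Sum>k=1..n. real k powr (t - 1) * (1 + ln (real k)) powr 0)) \<asymp> (\<lambda>n. real n powr t / t)"
    using assms by (intro sum_powr_ln_equiv_antiderivative)
      (auto intro!: derivative_eq_intros simp: powr_diff add_nonneg_eq_0_iff field_simps)
  \<comment> \<open>As \<open>0 powr 0 = 0\<close>, the artificial logarithmic factor is 1 only
    because its base is positive.\<close>
  moreover have "(1 + ln (real k)) powr 0 = 1" if "k \<ge> 1" for k
    using that one_plus_ln_pos[of "real k"] by simp
  ultimately show "(\<lambda>n. ennreal (\<Sum>k=1..n. real k powr (t - 1))) \<asymp> (\<lambda>n. real n powr t / t)"
    by (simp cong: sum.cong_simp)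
qed (use assms in auto)

text \<open>Trading the logarithm at \<open>k\<close> for the one at \<open>n\<close> leaves a sum
  of \<open>k powr (s / 2 - 1)\<close> in the upper bound and of \<open>k powr (2 * s - 1)\<close>
  in the lower one; the powers of \<open>n\<close> then recombine to
  \<open>n powr s\<close>.\<close>

lemma sum_powr_ln_equiv:
  assumes "s > 0"
  shows "(\<lambda>n. ennreal (\<Sum>k=1..n. real k powr (s - 1) * (1 + ln (real k)) powr b))
    \<asymp> (\<lambda>n. real n powr s * (1 + ln (real n)) powr b)"
proof -
  \<comment> \<open>Any exponent strictly between 0 and \<open>s\<close> would serve: the loss has
    to leave a sum of positive order.\<close>
  obtain D where D: "D > 0"
    "\<And>x y :: real. \<lbrakk>1 \<le> x; x \<le> y\<rbrakk> \<Longrightarrow> (1 + ln x) powr b \<le> D * (y / x) powr (s / 2) * (1 + ln y) powr b"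
    using ln_powr_ratio_bound[of "s / 2" b] assms by auto
  \<comment> \<open>The exponent \<open>- b\<close> turns the estimate into a lower bound for
    \<open>(1 + ln x) powr b\<close>; the loss now raises the order of the remaining sum, so the
    full \<open>s\<close> is harmless.\<close>
  obtain E where E: "E > 0"
    "\<And>x y :: real. \<lbrakk>1 \<le> x; x \<le> y\<rbrakk> \<Longrightarrow> (1 + ln x) powr - b \<le> E * (y / x) powr s * (1 + ln y) powr - b"
    using ln_powr_ratio_bound[of s "- b"] assms by auto
  obtain C where C: "C > 0" "\<And>n. n \<ge> 1 \<Longrightarrow> (\<Sum>k=1..n. real k powr (s / 2 - 1)) \<le> C * real n powr (s / 2)"
    using equiv_seq_ennrealE[OF sum_powr_equiv[of "s / 2"]] assms by (metis half_gt_zero powr_ge_zero sum_nonneg)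
  obtain c where c: "c > 0" "\<And>n. n \<ge> 1 \<Longrightarrow> c * real n powr (2 * s) \<le> (\<Sum>k=1..n. real k powr (2 * s - 1))"
    using equiv_seq_ennrealE[OF sum_powr_equiv[of "2 * s"]] assms
    by (metis powr_ge_zero sum_nonneg mult_pos_pos zero_less_numeral)
  show ?thesis
  proof (rule equiv_seqI)
    show "c / E > 0" "D * C > 0" using c C D E by auto
    fix n :: nat assume n: "n \<ge> 1"
    define L where "L = (1 + ln (real n)) powr b"
    have pos: "1 + ln (real k) > 0" if "k \<ge> 1" for k
      using that one_plus_ln_pos[of "real k"] by simp
    have L: "L > 0" using pos[OF n] by (simp add: L_def)
    have "(\<Sum>k=1..n. real k powr (s - 1) * (1 + ln (real k)) powr b)
        \<le> (\<Sum>k=1..n. D * real n powr (s / 2) * L * real k powr (s / 2 - 1))"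
    proof (rule sum_mono)
      fix k assume k: "k \<in> {1..n}"
      have "real k powr (s - 1) * (1 + ln (real k)) powr b
          \<le> real k powr (s - 1) * (D * (real n / real k) powr (s / 2) * L)"
        unfolding L_def using k by (intro mult_left_mono D) auto
      also have "\<dots> = D * real n powr (s / 2) * L * (real k powr (s - 1) / real k powr (s / 2))"
        using k by (simp add: powr_divide)
      also have "real k powr (s - 1) / real k powr (s / 2) = real k powr (s / 2 - 1)"
        using k by (simp add: powr_diff[symmetric] field_simps)
      finally show "real k powr (s - 1) * (1 + ln (real k)) powr b
          \<le> D * real n powr (s / 2) * L * real k powr (s / 2 - 1)" .
    qed
    also have "\<dots> = D * real n powr (s / 2) * L * (\<Sum>k=1..n. real k powr (s / 2 - 1))"
      by (simp add: sum_distrib_left)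
    also have "\<dots> \<le> D * real n powr (s / 2) * L * (C * real n powr (s / 2))"
      using D L n by (intro mult_left_mono C) auto
    also have "\<dots> = D * C * ((real n powr (s / 2) * real n powr (s / 2)) * L)"
      by simp
    also have "real n powr (s / 2) * real n powr (s / 2) = real n powr s"
      by (simp flip: powr_add)
    finally show "ennreal (\<Sum>k=1..n. real k powr (s - 1) * (1 + ln (real k)) powr b)
        \<le> ennreal (D * C * (real n powr s * (1 + ln (real n)) powr b))"
      by (simp add: L_def ennreal_leI)
    \<comment> \<open>Writing \<open>n powr s\<close> as \<open>n powr (2 * s) / n powr s\<close>
      lets the pure power sum enter.\<close>
    have "c / E * (real n powr s * L) = L / (E * real n powr s) * (c * real n powr (2 * s))"
      using n E powr_add[of "real n" s s] by (simp add: field_simps mult_2)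
    also have "\<dots> \<le> L / (E * real n powr s) * (\<Sum>k=1..n. real k powr (2 * s - 1))"
      using E L n by (intro mult_left_mono c) auto
    also have "\<dots> = (\<Sum>k=1..n. L / (E * real n powr s) * real k powr (2 * s - 1))"
      by (simp add: sum_distrib_left)
    also have "\<dots> \<le> (\<Sum>k=1..n. real k powr (s - 1) * (1 + ln (real k)) powr b)"
    proof (rule sum_mono)
      fix k assume k: "k \<in> {1..n}"
      have "1 / (1 + ln (real k)) powr b \<le> E * (real n / real k) powr s / L"
        using E(2)[of "real k" "real n"] k by (simp add: powr_minus L_def divide_inverse)
      then have "L / (E * real n powr s) * real k powr s \<le> (1 + ln (real k)) powr b"
        using E L pos[of k] n k by (simp add: powr_divide field_simps)
      then have "real k powr (s - 1) * (L / (E * real n powr s) * real k powr s)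
          \<le> real k powr (s - 1) * (1 + ln (real k)) powr b"
        by (intro mult_left_mono) auto
      moreover have "real k powr (2 * s - 1) = real k powr (s - 1) * real k powr s"
        by (simp flip: powr_add)
      ultimately show "L / (E * real n powr s) * real k powr (2 * s - 1)
          \<le> real k powr (s - 1) * (1 + ln (real k)) powr b"
        by (simp add: mult_ac)
    qed
    finally show "ennreal (c / E * (real n powr s * (1 + ln (real n)) powr b))
        \<le> ennreal (\<Sum>k=1..n. real k powr (s - 1) * (1 + ln (real k)) powr b)"
      unfolding L_def by (rule ennreal_leI)
  qed auto
qed

section \<open>Sums with power exponent -1\<close>

text \<open>The inner derivative \<open>1 / x\<close> is written \<open>x powr - 1\<close> to match
  the summands.\<close>

lemma one_plus_ln_powr_deriv:
  fixes x :: real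
  assumes "x \<ge> 1"
  shows "((\<lambda>x. (1 + ln x) powr (b + 1)) has_real_derivative (b + 1) * (x powr - 1 * (1 + ln x) powr b)) (at x)"
proof -
  have "((\<lambda>x. 1 + ln x) has_real_derivative 1 / x) (at x)"
    using assms by (auto intro!: derivative_eq_intros)
  from DERIV_fun_powr[OF this one_plus_ln_pos[OF assms], of "b + 1"] show ?thesis
    using assms by (simp add: powr_minus_divide)
qed

lemma sum_ln_powr_equiv_gt:
  assumes "b > -1"
  shows "(\<lambda>n. ennreal (\<Sum>k=1..n. real k powr - 1 * (1 + ln (real k)) powr b))
    \<asymp> (\<lambda>n. (1 + ln (real n)) powr (b + 1))"
proof (rule equiv_seq_trans_const)
  show "(\<lambda>n. ennreal (\<Sum>k=1..n. real k powr - 1 * (1 + ln (real k)) powr b))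
    \<asymp> (\<lambda>n. (1 + ln (real n)) powr (b + 1) / (b + 1))"
  proof (rule sum_powr_ln_equiv_antiderivative)
    fix x :: real assume "x \<ge> 1"
    from DERIV_cdivide[OF one_plus_ln_powr_deriv[OF this], of b "b + 1"]
    show "((\<lambda>x. (1 + ln x) powr (b + 1) / (b + 1)) has_real_derivative x powr - 1 * (1 + ln x) powr b) (at x)"
      using assms by simp
  qed (use assms in auto)
  show "1 / (b + 1) > 0" "1 / (b + 1) > 0" using assms by auto
qed auto

text \<open>The leading 1 is the constant of integration that makes the antiderivative
  \<open>1 + ln (1 + ln x)\<close> positive at 1.\<close>

lemma sum_ln_powr_equiv_eq:
  "(\<lambda>n. ennreal (\<Sum>k=1..n. real k powr - 1 * (1 + ln (real k)) powr - 1))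
    \<asymp> (\<lambda>n. 1 + ln (1 + ln (real n)))"
  using one_plus_ln_pos by (intro sum_powr_ln_equiv_antiderivative)
    (auto intro!: derivative_eq_intros simp: powr_minus_divide field_simps)

text \<open>As \<open>b + 1 < 0\<close>, the power \<open>(1 + ln n) powr (b + 1)\<close> stays in
  \<open>(0, 1]\<close>. Subtracting it from 2 gives an increasing antiderivative, after scaling,
  whose numerator stays between 1 and 2.\<close>

lemma sum_ln_powr_equiv_lt:
  assumes "b < -1"
  shows "(\<lambda>n. ennreal (\<Sum>k=1..n. real k powr - 1 * (1 + ln (real k)) powr b)) \<asymp> (\<lambda>n. 1)"
proof (rule equiv_seq_trans_const)
  show "(\<lambda>n. ennreal (\<Sum>k=1..n. real k powr - 1 * (1 + ln (real k)) powr b))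
    \<asymp> (\<lambda>n. (2 - (1 + ln (real n)) powr (b + 1)) / (- (b + 1)))"
  proof (rule sum_powr_ln_equiv_antiderivative)
    have cancel: "(0 - c * y) / (- c) = y" if "c \<noteq> 0" for c y :: real
      using that by simp
    fix x :: real assume "x \<ge> 1"
    from DERIV_cdivide[OF DERIV_diff[OF DERIV_const one_plus_ln_powr_deriv[OF this]], of 2 b "- (b + 1)"]
    show "((\<lambda>x. (2 - (1 + ln x) powr (b + 1)) / (- (b + 1))) has_real_derivative x powr - 1 * (1 + ln x) powr b) (at x)"
      by (rule DERIV_cong) (rule cancel, use assms in simp)
  qed (use assms in auto)
  show "1 / (- (b + 1)) > 0" "2 / (- (b + 1)) > 0" using assms by auto
  fix n :: nat assume "n \<ge> 1"
  then have "(1 + ln (real n)) powr (b + 1) \<le> 1 powr (b + 1)"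
    using assms by (intro powr_mono2') auto
  then have "1 \<le> 2 - (1 + ln (real n)) powr (b + 1)" by simp
  then show "1 / (- (b + 1)) * 1 \<le> (2 - (1 + ln (real n)) powr (b + 1)) / (- (b + 1))"
    using assms unfolding mult_1_right by (intro divide_right_mono) auto
  show "(2 - (1 + ln (real n)) powr (b + 1)) / (- (b + 1)) \<le> 2 / (- (b + 1)) * 1"
    using assms unfolding mult_1_right by (intro divide_right_mono) auto
qed

section \<open>Transfer to fundamental sequences\<close>

lemma fundamental_lz_equiv_finite:
  assumes "0 < q" "q < \<infinity>" "\<And>n. n \<ge> 1 \<Longrightarrow> 0 \<le> y n"
    and "(\<lambda>n. ennreal (\<Sum>k=1..n. real k powr (enn2real q * recip p - 1) *
      (1 + ln (real k)) powr (\<alpha> * enn2real q))) \<asymp> y"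
    and "\<And>n. n \<ge> 1 \<Longrightarrow> z n = y n powr recip q"
  shows "fundamental_lz p q \<alpha> \<asymp> z"
proof -
  have "0 \<le> recip q" by (simp add: recip_def)
  then have "fundamental_lz p q \<alpha> \<asymp> (\<lambda>n. y n powr recip q)"
    unfolding fundamental_lz_finite[OF assms(1,2)]
    using assms(3,4) by (intro equiv_seq_powr) (auto intro: sum_nonneg)
  then show ?thesis using assms(5) unfolding equiv_seq_def by simp
qed

text \<open>A supremum is at least each of its members, so requiring \<open>z n\<close> to be one of
  the weights yields the lower bound with constant 1.\<close>

lemma fundamental_lz_equiv_infinity:
  assumes "D > 0" "\<And>n. n \<ge> 1 \<Longrightarrow> 0 \<le> z n"
    and "\<And>k n. \<lbrakk>1 \<le> k; k \<le> n\<rbrakk> \<Longrightarrow> real k powr recip p * (1 + ln (real k)) powr \<alpha> \<le> D * z n"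
    and "\<And>n. n \<ge> 1 \<Longrightarrow> \<exists>k\<in>{1..n}. z n = real k powr recip p * (1 + ln (real k)) powr \<alpha>"
  shows "fundamental_lz p \<infinity> \<alpha> \<asymp> z"
proof (rule equiv_seqI)
  fix n :: nat assume n: "n \<ge> 1"
  show "fundamental_lz p \<infinity> \<alpha> n \<le> ennreal (D * z n)"
    unfolding fundamental_lz_infinity using assms(3) by (intro SUP_least ennreal_leI) auto
  obtain k where "k \<in> {1..n}" "z n = real k powr recip p * (1 + ln (real k)) powr \<alpha>"
    using assms(4)[OF n] by blast
  then show "ennreal (1 * z n) \<le> fundamental_lz p \<infinity> \<alpha> n"
    unfolding fundamental_lz_infinity by (intro SUP_upper2[of k]) auto
qed (use assms in auto)

section \<open>The six cases\<close>

theorem proposition5p6: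
  fixes p q :: ennreal and \<alpha> :: real
  assumes "0 < p" and "0 < q"
  shows "(p < \<infinity> \<longrightarrow>
      fundamental_lz p q \<alpha> \<asymp> (\<lambda>n. real n powr recip p * (1 + ln (real n)) powr \<alpha>)) \<and>
    (p = \<infinity> \<and> q < \<infinity> \<and> \<alpha> > - recip q \<longrightarrow>
      fundamental_lz p q \<alpha> \<asymp> (\<lambda>n. (1 + ln (real n)) powr (\<alpha> + recip q))) \<and>
    (p = \<infinity> \<and> q < \<infinity> \<and> \<alpha> = - recip q \<longrightarrow>
      fundamental_lz p q \<alpha> \<asymp> (\<lambda>n. (1 + ln (1 + ln (real n))) powr (- \<alpha>))) \<and>
    (p = \<infinity> \<and> q < \<infinity> \<and> \<alpha> < - recip q \<longrightarrow>
      fundamental_lz p q \<alpha> \<asymp> (\<lambda>n. 1)) \<and>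
    (p = \<infinity> \<and> q = \<infinity> \<and> \<alpha> > 0 \<longrightarrow>
      fundamental_lz p q \<alpha> \<asymp> (\<lambda>n. (1 + ln (real n)) powr \<alpha>)) \<and>
    (p = \<infinity> \<and> q = \<infinity> \<and> \<alpha> \<le> 0 \<longrightarrow>
      fundamental_lz p q \<alpha> \<asymp> (\<lambda>n. 1))"
proof (intro conjI impI; (elim conjE)?)
  assume p: "p < \<infinity>"
  have rp: "recip p > 0" using recip_pos[OF assms(1) p] .
  show "fundamental_lz p q \<alpha> \<asymp> (\<lambda>n. real n powr recip p * (1 + ln (real n)) powr \<alpha>)"
  proof (cases "q = \<infinity>")
    case True
    \<comment> \<open>With \<open>\<epsilon> = 1/p\<close> the loss
      \<open>(n / k) powr \<epsilon>\<close> times \<open>k powr (1/p)\<close> is exactly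
      \<open>n powr (1/p)\<close>, so the weight at \<open>n\<close> is maximal up to
      \<open>D\<close>.\<close>
    obtain D where D: "D > 0"
      "\<And>x y :: real. \<lbrakk>1 \<le> x; x \<le> y\<rbrakk> \<Longrightarrow> (1 + ln x) powr \<alpha> \<le> D * (y / x) powr recip p * (1 + ln y) powr \<alpha>"
      using ln_powr_ratio_bound[OF rp, of \<alpha>] by auto
    show ?thesis
      unfolding True
    proof (rule fundamental_lz_equiv_infinity[OF D(1)])
      fix k n :: nat assume k: "1 \<le> k" "k \<le> n"
      have "real k powr recip p * (1 + ln (real k)) powr \<alpha>
          \<le> real k powr recip p * (D * (real n / real k) powr recip p * (1 + ln (real n)) powr \<alpha>)"
        using k by (intro mult_left_mono D) auto
      then show "real k powr recip p * (1 + ln (real k)) powr \<alpha>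
          \<le> D * (real n powr recip p * (1 + ln (real n)) powr \<alpha>)"
        using k by (simp add: powr_divide)
    qed force+
  next
    case False
    then have q: "q < \<infinity>" by (simp add: less_top)
    then have Q: "enn2real q > 0" using assms by (simp add: enn2real_positive_iff less_top)
    show ?thesis
    \<comment> \<open>Applied with \<open>s = q/p\<close> and \<open>b = \<alpha> q\<close>; the
      root of order \<open>q\<close> brings back \<open>1/p\<close> and
      \<open>\<alpha>\<close>.\<close>
    proof (rule fundamental_lz_equiv_finite[OF assms(2) q _ sum_powr_ln_equiv])
      fix n :: nat
      show "real n powr recip p * (1 + ln (real n)) powr \<alpha>
        = (real n powr (enn2real q * recip p) * (1 + ln (real n)) powr (\<alpha> * enn2real q)) powr recip q"
        using Q by (simp add: powr_mult powr_powr recip_eq_inverse[OF assms(2) q])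
    qed (use Q rp in auto)
  qed
next
  assume pq: "p = \<infinity>" "q < \<infinity>" "\<alpha> > - recip q"
  then have Q: "enn2real q > 0" using assms by (simp add: enn2real_positive_iff less_top)
  note r = recip_eq_inverse[OF assms(2) pq(2)]
  have b: "\<alpha> * enn2real q > -1" using pq(3) Q by (simp add: r field_simps)
  show "fundamental_lz p q \<alpha> \<asymp> (\<lambda>n. (1 + ln (real n)) powr (\<alpha> + recip q))"
  proof (rule fundamental_lz_equiv_finite[OF assms(2) pq(2)])
    show "(\<lambda>n. ennreal (\<Sum>k=1..n. real k powr (enn2real q * recip p - 1) *
        (1 + ln (real k)) powr (\<alpha> * enn2real q))) \<asymp> (\<lambda>n. (1 + ln (real n)) powr (\<alpha> * enn2real q + 1))"
      using sum_ln_powr_equiv_gt[OF b] pq(1) by simp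
  qed (use Q in \<open>auto simp: powr_powr r field_simps\<close>)
next
  assume pq: "p = \<infinity>" "q < \<infinity>" "\<alpha> = - recip q"
  then have Q: "enn2real q > 0" using assms by (simp add: enn2real_positive_iff less_top)
  note r = recip_eq_inverse[OF assms(2) pq(2)]
  have b: "\<alpha> * enn2real q = -1" using pq(3) Q by (simp add: r field_simps)
  \<comment> \<open>The exponent \<open>- \<alpha>\<close> is the root \<open>1/q\<close> of the
    double logarithm.\<close>
  show "fundamental_lz p q \<alpha> \<asymp> (\<lambda>n. (1 + ln (1 + ln (real n))) powr (- \<alpha>))"
  proof (rule fundamental_lz_equiv_finite[OF assms(2) pq(2)])
    show "(\<lambda>n. ennreal (\<Sum>k=1..n. real k powr (enn2real q * recip p - 1) *
        (1 + ln (real k)) powr (\<alpha> * enn2real q))) \<asymp> (\<lambda>n. 1 + ln (1 + ln (real n)))"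
      using sum_ln_powr_equiv_eq pq(1) unfolding b by simp
  qed (use pq(3) in \<open>auto intro!: add_nonneg_nonneg ln_ge_zero\<close>)
next
  assume pq: "p = \<infinity>" "q < \<infinity>" "\<alpha> < - recip q"
  then have Q: "enn2real q > 0" using assms by (simp add: enn2real_positive_iff less_top)
  note r = recip_eq_inverse[OF assms(2) pq(2)]
  have b: "\<alpha> * enn2real q < -1" using pq(3) Q by (simp add: r field_simps)
  show "fundamental_lz p q \<alpha> \<asymp> (\<lambda>n. 1)"
  proof (rule fundamental_lz_equiv_finite[OF assms(2) pq(2)])
    show "(\<lambda>n. ennreal (\<Sum>k=1..n. real k powr (enn2real q * recip p - 1) *
        (1 + ln (real k)) powr (\<alpha> * enn2real q))) \<asymp> (\<lambda>n. 1)"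
      using sum_ln_powr_equiv_lt[OF b] pq(1) by simp
  qed auto
next
  assume pq: "p = \<infinity>" "q = \<infinity>" "\<alpha> > 0"
  show "fundamental_lz p q \<alpha> \<asymp> (\<lambda>n. (1 + ln (real n)) powr \<alpha>)"
    unfolding pq(1,2)
  \<comment> \<open>The weights increase, so the maximum sits at \<open>k = n\<close>.\<close>
  proof (rule fundamental_lz_equiv_infinity[of 1])
    fix k n :: nat assume k: "1 \<le> k" "k \<le> n"
    then show "real k powr recip \<infinity> * (1 + ln (real k)) powr \<alpha> \<le> 1 * (1 + ln (real n)) powr \<alpha>"
      using pq(3) by (auto intro!: powr_mono2 add_nonneg_nonneg)
  qed force+
next
  assume pq: "p = \<infinity>" "q = \<infinity>" "\<alpha> \<le> 0"
  show "fundamental_lz p q \<alpha> \<asymp> (\<lambda>n. 1)"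
    unfolding pq(1,2)
  \<comment> \<open>The weights do not increase, so the maximum is the weight 1 at
    \<open>k = 1\<close>.\<close>
  proof (rule fundamental_lz_equiv_infinity[of 1])
    fix k n :: nat assume k: "1 \<le> k" "k \<le> n"
    then have "(1 + ln (real k)) powr \<alpha> \<le> 1 powr \<alpha>"
      using pq(3) by (intro powr_mono2') auto
    then show "real k powr recip \<infinity> * (1 + ln (real k)) powr \<alpha> \<le> 1 * 1"
      using k by simp
  next
    fix n :: nat assume "n \<ge> 1"
    then show "\<exists>k\<in>{1..n}. 1 = real k powr recip \<infinity> * (1 + ln (real k)) powr \<alpha>"
      by (intro bexI[of _ 1]) auto
  qed auto
qed

end
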